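(* Let $L$ be a $\kappa$-frame. Every congruence on $L$ is a meet (intersection) of clear congruences on $L$.
   Context: Here $\kappa$ is either an infinite regular cardinal or the symbol $\infty$. A $\kappa$-set is a set of cardinality less than $\kappa$ (any set if $\kappa=\infty$). A $\kappa$-frame is a bounded distributive lattice with joins of all $\kappa$-sets, over which binary meets distribute; for $\kappa=\infty$ this is a frame. A congruence on $L$ is an equivalence relation on $L$ closed under finite meets and $\kappa$-joins in $L\times L$; congruences are ordered by inclusion and form a complete lattice $\mathbb{C}L$, with meets given by intersection (the empty meet is $L\times L$). A $\kappa$-ideal on $L$ is a downset closed under $\kappa$-joins (for $\kappa=\infty$, a principal ideal). For a $\kappa$-ideal $I$, let $\widetilde\nabla_I=\bigvee_{a\in I}\nabla_a$ where $\nabla_a$ is the congruence generated by $(0,a)$. The closure $\mathrm{cl}(C)$ of a congruence $C$ is the largest congruence of the form $\widetilde\nabla_I$ contained in $C$. For $D\le C$, $C$ is dense in $D$ if $\mathrm{cl}(C)\le D$. For each $\kappa$-ideal $I$ there is a largest congruence $\partial_I$ dense in $\widetilde\nabla_I$; explicitly $\partial_I=\{(a,b)\mid \forall x\in L:\ a\wedge x\in I\iff b\wedge x\in I\}$. A congruence of the form $\partial_I$ is called clear. *)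

theory Defs
  imports "HOL-Library.Lub_Glb" "HOL-Library.Product_Order"
begin

unbundle cardinal_syntax

text \<open>
  A cardinal is represented, as in the HOL library, by a cardinal order on some type;
  \<open>Infty\<close> is the symbol \<open>\<infinity>\<close>.
\<close>

datatype 'k bound = Card "'k rel" | Infty

fun regular_bound :: "'k bound \<Rightarrow> bool" where
  "regular_bound (Card r) \<longleftrightarrow> Cinfinite r \<and> regularCard r"
| "regular_bound Infty \<longleftrightarrow> True"

fun kset :: "'k bound \<Rightarrow> 'a set \<Rightarrow> bool" where
  "kset (Card r) S \<longleftrightarrow> |S| <o r"
| "kset Infty S \<longleftrightarrow> True"

abbreviation is_join :: "'a::order set \<Rightarrow> 'a \<Rightarrow> bool" where
  "is_join S s \<equiv> isLub UNIV S s"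

text \<open>
  The carrier of a lattice is the whole type. Lattices with \<open>bot = top\<close> are allowed.
\<close>

definition kframe :: "'k bound \<Rightarrow> 'a::{bounded_lattice,distrib_lattice} itself \<Rightarrow> bool" where
  "kframe \<kappa> L \<longleftrightarrow>
     (\<forall>S::'a set. kset \<kappa> S \<longrightarrow>
        (\<exists>s. is_join S s \<and> (\<forall>a. is_join ((\<lambda>x. inf a x) ` S) (inf a s))))"

text \<open>
  Meets, joins and the top element of pairs are those of the componentwise order on
  \<open>'a \<times> 'a\<close>.
\<close>

definition kcong :: "'k bound \<Rightarrow> 'a::{bounded_lattice,distrib_lattice} rel \<Rightarrow> bool" where
  "kcong \<kappa> C \<longleftrightarrow>
     equiv UNIV C \<and>
     top \<in> C \<and> (\<forall>p\<in>C. \<forall>q\<in>C. inf p q \<in> C) \<and>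
     (\<forall>R s. R \<subseteq> C \<longrightarrow> kset \<kappa> R \<longrightarrow> is_join R s \<longrightarrow> s \<in> C)"

definition cong_gen :: "'k bound \<Rightarrow> 'a::{bounded_lattice,distrib_lattice} rel \<Rightarrow> 'a rel" where
  "cong_gen \<kappa> R = \<Inter>{C. kcong \<kappa> C \<and> R \<subseteq> C}"

definition cong_join :: "'k bound \<Rightarrow> 'a::{bounded_lattice,distrib_lattice} rel set \<Rightarrow> 'a rel" where
  "cong_join \<kappa> F = cong_gen \<kappa> (\<Union>F)"

definition kideal :: "'k bound \<Rightarrow> 'a::{bounded_lattice,distrib_lattice} set \<Rightarrow> bool" where
  "kideal \<kappa> I \<longleftrightarrow>
     (\<forall>a\<in>I. \<forall>b\<le>a. b \<in> I) \<and>
     (\<forall>S s. S \<subseteq> I \<longrightarrow> kset \<kappa> S \<longrightarrow> is_join S s \<longrightarrow> s \<in> I)"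

definition nabla :: "'k bound \<Rightarrow> 'a::{bounded_lattice,distrib_lattice} \<Rightarrow> 'a rel" where
  "nabla \<kappa> a = cong_gen \<kappa> {(bot, a)}"

definition nabla_ideal :: "'k bound \<Rightarrow> 'a::{bounded_lattice,distrib_lattice} set \<Rightarrow> 'a rel" where
  "nabla_ideal \<kappa> I = cong_join \<kappa> (nabla \<kappa> ` I)"

definition cong_cl :: "'k bound \<Rightarrow> 'a::{bounded_lattice,distrib_lattice} rel \<Rightarrow> 'a rel" where
  "cong_cl \<kappa> C = (GREATEST D. (\<exists>I. kideal \<kappa> I \<and> D = nabla_ideal \<kappa> I) \<and> D \<subseteq> C)"

definition dense_in ::
  "'k bound \<Rightarrow> 'a::{bounded_lattice,distrib_lattice} rel \<Rightarrow> 'a rel \<Rightarrow> bool" where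
  "dense_in \<kappa> C D \<longleftrightarrow> D \<subseteq> C \<and> cong_cl \<kappa> C \<subseteq> D"

definition boundary :: "'k bound \<Rightarrow> 'a::{bounded_lattice,distrib_lattice} set \<Rightarrow> 'a rel" where
  "boundary \<kappa> I = (GREATEST C. kcong \<kappa> C \<and> dense_in \<kappa> C (nabla_ideal \<kappa> I))"

definition clear_cong :: "'k bound \<Rightarrow> 'a::{bounded_lattice,distrib_lattice} rel \<Rightarrow> bool" where
  "clear_cong \<kappa> C \<longleftrightarrow> (\<exists>I. kideal \<kappa> I \<and> C = boundary \<kappa> I)"

end

theory Submission
  imports Defs
begin

text \<open>
  Write \<open>x \<le>\<^sub>C c\<close> for \<open>(x \<sqinter> c, x) \<in> C\<close>, the order of the quotient \<open>L / C\<close>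
  pulled back to \<open>L\<close>. For each \<open>c\<close> the set \<open>I\<^sub>c = {x. x \<le>\<^sub>C c}\<close> is a \<open>\<kappa>\<close>-ideal,
  being the preimage of a principal ideal of the quotient, and \<open>C\<close> is the intersection of the
  clear congruences \<open>\<partial>\<close> of the ideals \<open>I\<^sub>c\<close>. Indeed, membership in \<open>I\<^sub>c\<close> is invariant
  under \<open>C\<close>, so \<open>C\<close> is contained in each of them. Conversely, a pair \<open>(a, b)\<close> in all of them
  satisfies \<open>a \<le>\<^sub>C b\<close>, because \<open>b \<in> I\<^sub>b\<close>, and \<open>b \<le>\<^sub>C a\<close>, because \<open>a \<in> I\<^sub>a\<close>;
  by antisymmetry in the quotient, \<open>(a, b) \<in> C\<close>.

  This argument uses the explicit description of \<open>\<partial>\<close> (lemma \<open>boundary_eq\<close>), which has to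
  be derived from its definition as the largest congruence dense in the congruence of \<open>I\<close>. What
  makes this work is a Galois connection: the congruence of an ideal \<open>I\<close> lies in a congruence
  \<open>C\<close> iff \<open>I\<close> lies in the zero class \<open>I\<^sub>\<bottom>\<close> of \<open>C\<close>
  (lemma \<open>nabla_ideal_subset_iff\<close>). Hence the closure of \<open>C\<close> is the congruence of the zero
  class of \<open>C\<close>, and \<open>C\<close> is dense in the congruence of \<open>I\<close> exactly when its zero class is
  \<open>I\<close>. So \<open>\<partial>\<close> must be the largest congruence with zero class \<open>I\<close>, which is the
  syntactic congruence of \<open>I\<close> with respect to meets.
\<close>

section \<open>Small joins and congruences\<close>

lemma is_join_iff:
  "is_join S s \<longleftrightarrow> (\<forall>x\<in>S. x \<le> s) \<and> (\<forall>u. (\<forall>x\<in>S. x \<le> u) \<longrightarrow> s \<le> u)"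
  by (auto simp: isLub_def leastP_def isUb_def setle_def setge_def)

lemma is_join_unique: "is_join S s \<Longrightarrow> is_join S t \<Longrightarrow> s = t"
  by (meson antisym is_join_iff)

lemma is_join_empty: "is_join {} (bot::'a::{bounded_lattice,distrib_lattice})"
  by (simp add: is_join_iff)

lemma is_join_pair:
  "is_join R (s, t) \<longleftrightarrow> is_join (fst ` R) s \<and> is_join (snd ` R) t"
proof
  assume R: "is_join R (s, t)"
  have "s \<le> u" if "\<forall>x\<in>R. fst x \<le> u" for u
  proof -
    have "\<forall>x\<in>R. x \<le> (u, t)"
      using that R by (auto simp: is_join_iff less_eq_prod_def)
    then have "(s, t) \<le> (u, t)"
      using R unfolding is_join_iff by blast
    then show ?thesis by simp
  qed
  moreover have "t \<le> u" if "\<forall>x\<in>R. snd x \<le> u" for u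
  proof -
    have "\<forall>x\<in>R. x \<le> (s, u)"
      using that R by (auto simp: is_join_iff less_eq_prod_def)
    then have "(s, t) \<le> (s, u)"
      using R unfolding is_join_iff by blast
    then show ?thesis by simp
  qed
  ultimately show "is_join (fst ` R) s \<and> is_join (snd ` R) t"
    using R by (auto simp: is_join_iff less_eq_prod_def)
next
  assume "is_join (fst ` R) s \<and> is_join (snd ` R) t"
  then show "is_join R (s, t)"
    by (auto simp: is_join_iff less_eq_prod_def)
qed

lemma kset_image: "kset \<kappa> S \<Longrightarrow> kset \<kappa> (f ` S)"
  by (cases \<kappa>) (auto intro: ordLeq_ordLess_trans card_of_image)

lemma kset_empty:
  assumes "regular_bound \<kappa>"
  shows "kset \<kappa> ({} :: 'b set)"
proof (cases \<kappa>)
  case (Card r)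
  with assms have "Cinfinite r" by simp
  moreover have "Cfinite |{} :: 'b set|"
    using card_of_card_order_on by (simp add: cfinite_def Field_card_of)
  ultimately show ?thesis
    using Cfinite_ordLess_Cinfinite by (simp add: Card)
qed simp

lemma kframe_join_inf:
  fixes a s :: "'a::{bounded_lattice,distrib_lattice}"
  assumes "kframe \<kappa> TYPE('a)" "kset \<kappa> S" "is_join S s"
  shows "is_join ((\<lambda>x. inf x a) ` S) (inf s a)"
proof -
  obtain t where t: "is_join S t" "\<forall>a. is_join ((\<lambda>x. inf a x) ` S) (inf a t)"
    using assms(1,2) unfolding kframe_def by blast
  then have "t = s"
    using is_join_unique assms(3) by blast
  moreover have "(\<lambda>x. inf x a) = inf a" "inf s a = inf a s"
    by (simp_all add: fun_eq_iff inf_commute)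
  ultimately show ?thesis
    using t(2) by metis
qed

context
  fixes \<kappa> :: "'k bound" and C :: "'a::{bounded_lattice,distrib_lattice} rel"
  assumes C: "kcong \<kappa> C"
begin

lemma kcong_refl: "(a, a) \<in> C"
  using C by (auto simp: kcong_def equiv_def refl_on_def)

lemma kcong_sym: "(a, b) \<in> C \<Longrightarrow> (b, a) \<in> C"
  using C by (auto simp: kcong_def equiv_def sym_def)

lemma kcong_trans: "(a, b) \<in> C \<Longrightarrow> (b, c) \<in> C \<Longrightarrow> (a, c) \<in> C"
  using C by (auto simp: kcong_def equiv_def trans_def)

lemma kcong_inf: "(a, b) \<in> C \<Longrightarrow> (inf a x, inf b x) \<in> C"
  using C kcong_refl[of x] unfolding kcong_def by (metis inf_Pair_Pair)

lemma kcong_join: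
  assumes "kset \<kappa> S" "\<And>x. x \<in> S \<Longrightarrow> (f x, g x) \<in> C"
    and "is_join (f ` S) s" "is_join (g ` S) t"
  shows "(s, t) \<in> C"
proof -
  let ?R = "(\<lambda>x. (f x, g x)) ` S"
  have "is_join ?R (s, t)"
    using assms(3,4) by (simp add: is_join_pair image_image)
  moreover have "?R \<subseteq> C" "kset \<kappa> ?R"
    using assms(1,2) by (auto intro: kset_image)
  ultimately show ?thesis
    using C unfolding kcong_def by blast
qed

end

section \<open>The ideals of elements below a given one in the quotient\<close>

definition quotient_below ::
  "'a::{bounded_lattice,distrib_lattice} rel \<Rightarrow> 'a \<Rightarrow> 'a set" where
  "quotient_below C c = {x. (inf x c, x) \<in> C}"

lemma quotient_below_bot: "x \<in> quotient_below C bot \<longleftrightarrow> (bot, x) \<in> C"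
  by (simp add: quotient_below_def)

lemma kideal_quotient_below:
  fixes C :: "'a::{bounded_lattice,distrib_lattice} rel"
  assumes "kframe \<kappa> TYPE('a)" and C: "kcong \<kappa> C"
  shows "kideal \<kappa> (quotient_below C c)"
  unfolding kideal_def
proof (intro conjI ballI allI impI)
  fix a b assume "a \<in> quotient_below C c" "b \<le> a"
  then have "(inf (inf a c) b, inf a b) \<in> C"
    using kcong_inf[OF C] by (simp add: quotient_below_def)
  moreover have "inf a b = b" "inf (inf a c) b = inf b c"
    using \<open>b \<le> a\<close> by (metis inf.absorb2 inf.assoc inf.commute)+
  ultimately show "b \<in> quotient_below C c"
    by (simp add: quotient_below_def)
next
  fix S s assume S: "S \<subseteq> quotient_below C c" "kset \<kappa> S" "is_join S s"
  have "is_join ((\<lambda>x. inf x c) ` S) (inf s c)"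
    using kframe_join_inf assms(1) S(2,3) by blast
  moreover have "(inf x c, x) \<in> C" if "x \<in> S" for x
    using S(1) that by (auto simp: quotient_below_def)
  ultimately show "s \<in> quotient_below C c"
    using kcong_join[OF C S(2), of "\<lambda>x. inf x c" "\<lambda>x. x"] S(3)
    by (simp add: quotient_below_def)
qed

text \<open>
  Related elements have the same class, hence lie below the same elements of the quotient.
\<close>

lemma quotient_below_cong:
  assumes C: "kcong \<kappa> C" and "(a, b) \<in> C"
  shows "a \<in> quotient_below C c \<longleftrightarrow> b \<in> quotient_below C c"
  using assms(2) kcong_inf[OF C assms(2), of c] kcong_sym[OF C] kcong_trans[OF C]
  unfolding quotient_below_def by blast

section \<open>Closure and density\<close>

text \<open>
  This is the Galois connection between ideals and congruences: a congruence absorbs an ideal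
  generator by generator.
\<close>

lemma nabla_ideal_subset_iff:
  assumes "kcong \<kappa> C"
  shows "nabla_ideal \<kappa> I \<subseteq> C \<longleftrightarrow> I \<subseteq> quotient_below C bot"
proof
  have "(bot, a) \<in> nabla_ideal \<kappa> I" if "a \<in> I" for a
    using that unfolding nabla_ideal_def cong_join_def nabla_def cong_gen_def by blast
  then show "I \<subseteq> quotient_below C bot" if "nabla_ideal \<kappa> I \<subseteq> C"
    using that by (meson quotient_below_bot subset_iff)
next
  assume "I \<subseteq> quotient_below C bot"
  then have "nabla \<kappa> a \<subseteq> C" if "a \<in> I" for a
    using that assms unfolding nabla_def cong_gen_def by (auto simp: quotient_below_bot)
  then show "nabla_ideal \<kappa> I \<subseteq> C"
    using assms unfolding nabla_ideal_def cong_join_def cong_gen_def by blast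
qed

lemma nabla_ideal_mono: "I \<subseteq> J \<Longrightarrow> nabla_ideal \<kappa> I \<subseteq> nabla_ideal \<kappa> J"
  unfolding nabla_ideal_def cong_join_def cong_gen_def by blast

lemma cong_cl_eq:
  fixes C :: "'a::{bounded_lattice,distrib_lattice} rel"
  assumes "kframe \<kappa> TYPE('a)" "kcong \<kappa> C"
  shows "cong_cl \<kappa> C = nabla_ideal \<kappa> (quotient_below C bot)"
  unfolding cong_cl_def
proof (rule Greatest_equality)
  show "(\<exists>I. kideal \<kappa> I \<and> nabla_ideal \<kappa> (quotient_below C bot) = nabla_ideal \<kappa> I) \<and>
      nabla_ideal \<kappa> (quotient_below C bot) \<subseteq> C"
    using kideal_quotient_below[OF assms] nabla_ideal_subset_iff[OF assms(2)] by blast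
next
  fix D assume "(\<exists>I. kideal \<kappa> I \<and> D = nabla_ideal \<kappa> I) \<and> D \<subseteq> C"
  then show "D \<le> nabla_ideal \<kappa> (quotient_below C bot)"
    using nabla_ideal_subset_iff[OF assms(2)] nabla_ideal_mono by metis
qed

section \<open>The explicit form of clear congruences\<close>

definition syntactic_cong :: "'a::{bounded_lattice,distrib_lattice} set \<Rightarrow> 'a rel" where
  "syntactic_cong I = {(a, b). \<forall>x. inf a x \<in> I \<longleftrightarrow> inf b x \<in> I}"

text \<open>
  Compatibility with joins is where distributivity enters: for a small join \<open>s\<close> of \<open>S\<close>, the
  element \<open>s \<sqinter> x\<close> is the join of the elements \<open>r \<sqinter> x\<close> with \<open>r \<in> S\<close>, so it lies in
  the ideal iff all of them do.
\<close>

lemma kcong_syntactic_cong: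
  fixes I :: "'a::{bounded_lattice,distrib_lattice} set"
  assumes L: "kframe \<kappa> TYPE('a)" and I: "kideal \<kappa> I"
  shows "kcong \<kappa> (syntactic_cong I)"
proof -
  have join_in_iff: "inf s x \<in> I \<longleftrightarrow> (\<forall>r\<in>S. inf r x \<in> I)"
    if "kset \<kappa> S" "is_join S s" for S s x
  proof
    assume "inf s x \<in> I"
    moreover have "inf r x \<le> inf s x" if "r \<in> S" for r
      using \<open>is_join S s\<close> that by (meson inf_mono is_join_iff order_refl)
    ultimately show "\<forall>r\<in>S. inf r x \<in> I"
      using I unfolding kideal_def by blast
  next
    assume "\<forall>r\<in>S. inf r x \<in> I"
    then have "(\<lambda>r. inf r x) ` S \<subseteq> I" by blast
    then show "inf s x \<in> I"
      using I kset_image[OF that(1)] kframe_join_inf[OF L that] unfolding kideal_def by blast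
  qed
  have "equiv UNIV (syntactic_cong I)"
    by (auto simp: equiv_def refl_on_def sym_def trans_def syntactic_cong_def)
  moreover have "top \<in> syntactic_cong I"
    by (simp add: syntactic_cong_def top_prod_def)
  moreover have "inf p q \<in> syntactic_cong I"
    if p: "p \<in> syntactic_cong I" and q: "q \<in> syntactic_cong I" for p q
  proof -
    obtain a b c d where [simp]: "p = (a, b)" "q = (c, d)" by fastforce
    have "inf (inf a c) x \<in> I \<longleftrightarrow> inf (inf b d) x \<in> I" for x
    proof -
      have "inf (inf a c) x \<in> I \<longleftrightarrow> inf b (inf c x) \<in> I"
        using p by (simp add: syntactic_cong_def inf_assoc)
      also have "\<dots> \<longleftrightarrow> inf c (inf b x) \<in> I"
        by (simp add: inf_left_commute)
      also have "\<dots> \<longleftrightarrow> inf d (inf b x) \<in> I"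
        using q by (simp add: syntactic_cong_def)
      also have "\<dots> \<longleftrightarrow> inf (inf b d) x \<in> I"
        by (simp add: inf_assoc inf_left_commute)
      finally show ?thesis .
    qed
    then show ?thesis by (simp add: syntactic_cong_def)
  qed
  moreover have "p \<in> syntactic_cong I"
    if R: "R \<subseteq> syntactic_cong I" "kset \<kappa> R" "is_join R p" for R p
  proof -
    obtain s t where p: "p = (s, t)" by fastforce
    have "inf s x \<in> I \<longleftrightarrow> inf t x \<in> I" for x
    proof -
      have "inf s x \<in> I \<longleftrightarrow> (\<forall>r\<in>R. inf (fst r) x \<in> I)"
        using join_in_iff[OF kset_image[OF R(2)], of fst s x] R(3) by (simp add: p is_join_pair)
      also have "\<dots> \<longleftrightarrow> (\<forall>r\<in>R. inf (snd r) x \<in> I)"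
        using R(1) by (fastforce simp: syntactic_cong_def)
      also have "\<dots> \<longleftrightarrow> inf t x \<in> I"
        using join_in_iff[OF kset_image[OF R(2)], of snd t x] R(3) by (simp add: p is_join_pair)
      finally show ?thesis .
    qed
    then show ?thesis by (simp add: p syntactic_cong_def)
  qed
  ultimately show ?thesis
    unfolding kcong_def by blast
qed

lemma zero_class_syntactic_cong:
  fixes I :: "'a::{bounded_lattice,distrib_lattice} set"
  assumes "regular_bound \<kappa>" "kideal \<kappa> I"
  shows "quotient_below (syntactic_cong I) bot = I"
proof -
  have bot: "bot \<in> I"
    using assms(2) kset_empty[OF assms(1)] is_join_empty unfolding kideal_def by blast
  have "a \<in> quotient_below (syntactic_cong I) bot \<longleftrightarrow> a \<in> I" for a
  proof
    assume "a \<in> quotient_below (syntactic_cong I) bot"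
    then have "\<forall>x. inf a x \<in> I"
      using bot by (simp add: quotient_below_bot syntactic_cong_def)
    then show "a \<in> I"
      by (metis inf_top_right)
  next
    assume "a \<in> I"
    then have "inf a x \<in> I" for x
      using assms(2) unfolding kideal_def by (meson inf_le1)
    then show "a \<in> quotient_below (syntactic_cong I) bot"
      using bot by (simp add: quotient_below_bot syntactic_cong_def)
  qed
  then show ?thesis by blast
qed

text \<open>
  A congruence relating \<open>a\<close> and \<open>b\<close> also relates \<open>a \<sqinter> x\<close> and \<open>b \<sqinter> x\<close>, so these lie in its
  classes together.
\<close>

lemma kcong_subset_syntactic_cong:
  assumes "kcong \<kappa> C"
  shows "C \<subseteq> syntactic_cong (quotient_below C c)"
  using kcong_inf[OF assms] quotient_below_cong[OF assms]
  unfolding syntactic_cong_def by blast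

text \<open>
  Density compares congruences of ideals; it turns into equality of ideals because the zero class
  of the congruence of \<open>I\<close> is no larger than \<open>I\<close>, as witnessed by the syntactic congruence.
\<close>

lemma dense_in_nabla_ideal_iff:
  fixes C :: "'a::{bounded_lattice,distrib_lattice} rel"
  assumes "regular_bound \<kappa>" "kframe \<kappa> TYPE('a)" "kideal \<kappa> I" "kcong \<kappa> C"
  shows "dense_in \<kappa> C (nabla_ideal \<kappa> I) \<longleftrightarrow> quotient_below C bot = I"
proof
  let ?S = "syntactic_cong I"
  note S = kcong_syntactic_cong[OF assms(2,3)]
  note zero = zero_class_syntactic_cong[OF assms(1,3)]
  assume dense: "dense_in \<kappa> C (nabla_ideal \<kappa> I)"
  have "nabla_ideal \<kappa> (quotient_below C bot) \<subseteq> nabla_ideal \<kappa> I"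
    using dense cong_cl_eq[OF assms(2,4)] by (simp add: dense_in_def)
  also have "\<dots> \<subseteq> ?S"
    using nabla_ideal_subset_iff[OF S] zero by simp
  finally have "quotient_below C bot \<subseteq> I"
    using nabla_ideal_subset_iff[OF S] zero by simp
  moreover have "I \<subseteq> quotient_below C bot"
    using dense nabla_ideal_subset_iff[OF assms(4)] by (simp add: dense_in_def)
  ultimately show "quotient_below C bot = I" by blast
next
  assume "quotient_below C bot = I"
  then show "dense_in \<kappa> C (nabla_ideal \<kappa> I)"
    using nabla_ideal_subset_iff[OF assms(4)] cong_cl_eq[OF assms(2,4)]
    by (simp add: dense_in_def)
qed

lemma boundary_eq:
  fixes I :: "'a::{bounded_lattice,distrib_lattice} set"
  assumes "regular_bound \<kappa>" "kframe \<kappa> TYPE('a)" "kideal \<kappa> I"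
  shows "boundary \<kappa> I = syntactic_cong I"
  unfolding boundary_def
proof (rule Greatest_equality)
  show "kcong \<kappa> (syntactic_cong I) \<and> dense_in \<kappa> (syntactic_cong I) (nabla_ideal \<kappa> I)"
    using kcong_syntactic_cong[OF assms(2,3)] dense_in_nabla_ideal_iff[OF assms]
      zero_class_syntactic_cong[OF assms(1,3)] by blast
next
  fix C assume "kcong \<kappa> C \<and> dense_in \<kappa> C (nabla_ideal \<kappa> I)"
  then show "C \<le> syntactic_cong I"
    using kcong_subset_syntactic_cong dense_in_nabla_ideal_iff[OF assms] by metis
qed

section \<open>Congruences as intersections of clear congruences\<close>

theorem mainTheorem2:
  fixes \<kappa> :: "'k bound"
    and C :: "'a::{bounded_lattice,distrib_lattice} rel"
  assumes "regular_bound \<kappa>"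
    and "kframe \<kappa> TYPE('a)"
    and "kcong \<kappa> C"
  shows "\<exists>F. (\<forall>D\<in>F. clear_cong \<kappa> D) \<and> C = \<Inter>F"
proof -
  let ?F = "range (\<lambda>c. syntactic_cong (quotient_below C c))"
  have "\<forall>D\<in>?F. clear_cong \<kappa> D"
    using kideal_quotient_below[OF assms(2,3)] boundary_eq[OF assms(1,2)]
    unfolding clear_cong_def by blast
  moreover have "\<Inter>?F \<subseteq> C"
  proof (clarify)
    fix a b assume ab: "(a, b) \<in> \<Inter>?F"
    have "a \<in> quotient_below C c \<longleftrightarrow> b \<in> quotient_below C c" for c
    proof -
      have "\<forall>x. inf a x \<in> quotient_below C c \<longleftrightarrow> inf b x \<in> quotient_below C c"
        using ab by (simp add: syntactic_cong_def)
      then show ?thesis by (metis inf_top_right)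
    qed
    moreover have "a \<in> quotient_below C a" "b \<in> quotient_below C b"
      using kcong_refl[OF assms(3)] by (simp_all add: quotient_below_def)
    ultimately have "a \<in> quotient_below C b" "b \<in> quotient_below C a"
      by blast+
    then have "(inf a b, a) \<in> C" "(inf a b, b) \<in> C"
      by (simp_all add: quotient_below_def inf_commute[of b a])
    then show "(a, b) \<in> C"
      using kcong_sym[OF assms(3)] kcong_trans[OF assms(3)] by blast
  qed
  moreover have "C \<subseteq> \<Inter>?F"
    using kcong_subset_syntactic_cong[OF assms(3)] by blast
  ultimately show ?thesis by blast
qed

end
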